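(* Let $p\equiv 1\pmod 3$ be a prime, let $\eta_3$ be a primitive cubic character in $\widehat{\mathbb{F}_p^\times}$ (a character of exact order $3$), and let $\varepsilon$ denote the trivial character. If $\lambda\in\mathbb{F}_p$ satisfies $1+2\lambda\neq 0$, then $${}_2\mathbb{F}_1\left[\begin{matrix}\eta_3 & \eta_3^2\\ & \varepsilon\end{matrix};\,1-\lambda^3\right]={}_2\mathbb{F}_1\left[\begin{matrix}\eta_3 & \eta_3^2\\ & \varepsilon\end{matrix};\,\left(\frac{1-\lambda}{1+2\lambda}\right)^3\right].$$
   Context: For a finite field $\mathbb{F}_q$, $\widehat{\mathbb{F}_q^\times}$ is the group of complex-valued multiplicative characters of $\mathbb{F}_q^\times$; every character $\chi$, including the trivial character $\varepsilon$, is extended to $\mathbb{F}_q$ by $\chi(0)=0$, and $\overline{\chi}=\chi^{-1}$. The Jacobi sum is $J(A,B)=\sum_{x\in\mathbb{F}_q}A(x)B(1-x)$. For $A,B,C\in\widehat{\mathbb{F}_q^\times}$ and $\lambda\in\mathbb{F}_q$, $${}_2\mathbb{P}_1\left[\begin{matrix}A & B\\ & C\end{matrix};\lambda\right]=\sum_{y\in\mathbb{F}_q}B(y)\,C\overline{B}(1-y)\,\overline{A}(1-\lambda y),\qquad {}_2\mathbb{F}_1\left[\begin{matrix}A & B\\ & C\end{matrix};\lambda\right]=\frac{1}{J(B,C\overline{B})}\,{}_2\mathbb{P}_1\left[\begin{matrix}A & B\\ & C\end{matrix};\lambda\right].$$ *)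

theory Defs
  imports Complex_Main "HOL-Algebra.Multiplicative_Group" "HOL-Number_Theory.Cong"
begin

text \<open>Multiplicative characters of a field, extended to the whole field by the value
  \<open>0\<close> at \<open>0\<close>. In particular the trivial character also vanishes at \<open>0\<close>.\<close>

definition mult_char :: "('a::field \<Rightarrow> complex) \<Rightarrow> bool" where
  "mult_char \<chi> \<longleftrightarrow> \<chi> 0 = 0 \<and> \<chi> 1 = 1 \<and> (\<forall>x y. \<chi> (x * y) = \<chi> x * \<chi> y)"

definition triv_char :: "'a::field \<Rightarrow> complex" where
  "triv_char x = (if x = 0 then 0 else 1)"

definition char_group :: "('a::field \<Rightarrow> complex) monoid" where
  "char_group = \<lparr>carrier = {\<chi>. mult_char \<chi>}, monoid.mult = (\<lambda>\<chi> \<psi> x. \<chi> x * \<psi> x), one = triv_char\<rparr>"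

text \<open>The pointwise inverse is the inverse character also at \<open>0\<close>, since
  \<open>inverse 0 = 0\<close>; see \<open>inv_char_group\<close> below.\<close>

definition char_inv :: "('a::field \<Rightarrow> complex) \<Rightarrow> 'a \<Rightarrow> complex" where
  "char_inv \<chi> x = inverse (\<chi> x)"

definition jacobi_sum :: "('a::{field,finite} \<Rightarrow> complex) \<Rightarrow> ('a \<Rightarrow> complex) \<Rightarrow> complex" where
  "jacobi_sum A B = (\<Sum>x\<in>UNIV. A x * B (1 - x))"

definition hyp_P21 ::
  "('a::{field,finite} \<Rightarrow> complex) \<Rightarrow> ('a \<Rightarrow> complex) \<Rightarrow> ('a \<Rightarrow> complex) \<Rightarrow> 'a \<Rightarrow> complex" where
  "hyp_P21 A B C t =
     (\<Sum>y\<in>UNIV. B y * (C \<otimes>\<^bsub>char_group\<^esub> char_inv B) (1 - y) * char_inv A (1 - t * y))"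

definition hyp_F21 ::
  "('a::{field,finite} \<Rightarrow> complex) \<Rightarrow> ('a \<Rightarrow> complex) \<Rightarrow> ('a \<Rightarrow> complex) \<Rightarrow> 'a \<Rightarrow> complex" where
  "hyp_F21 A B C t = 1 / jacobi_sum B (C \<otimes>\<^bsub>char_group\<^esub> char_inv B) * hyp_P21 A B C t"

lemma mult_char_nonzero:
  assumes "mult_char \<chi>" "x \<noteq> 0"
  shows "\<chi> x \<noteq> 0"
proof
  assume "\<chi> x = 0"
  moreover have "\<chi> (x * inverse x) = \<chi> x * \<chi> (inverse x)"
    using assms(1) unfolding mult_char_def by blast
  ultimately show False
    using assms by (simp add: mult_char_def)
qed

lemma mult_char_char_inv: "mult_char \<chi> \<Longrightarrow> mult_char (char_inv \<chi>)"
  by (simp add: mult_char_def char_inv_def)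

lemma char_inv_mult:
  assumes "mult_char \<chi>"
  shows "char_inv \<chi> \<otimes>\<^bsub>char_group\<^esub> \<chi> = triv_char"
proof
  fix x
  show "(char_inv \<chi> \<otimes>\<^bsub>char_group\<^esub> \<chi>) x = triv_char x"
    using assms mult_char_nonzero[OF assms, of x]
    by (cases "x = 0") (auto simp: char_group_def char_inv_def triv_char_def mult_char_def)
qed

lemma comm_group_char_group: "comm_group char_group"
proof (rule comm_groupI)
  fix \<chi> :: "'a \<Rightarrow> complex"
  assume \<chi>: "\<chi> \<in> carrier char_group"
  then show "\<one>\<^bsub>char_group\<^esub> \<otimes>\<^bsub>char_group\<^esub> \<chi> = \<chi>"
    by (auto simp: char_group_def triv_char_def mult_char_def)
  show "\<exists>\<psi>\<in>carrier char_group. \<psi> \<otimes>\<^bsub>char_group\<^esub> \<chi> = \<one>\<^bsub>char_group\<^esub>"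
    using \<chi> char_inv_mult[of \<chi>] mult_char_char_inv[of \<chi>]
    by (auto simp: char_group_def)
qed (auto simp: char_group_def mult_char_def triv_char_def mult_ac)

lemma inv_char_group:
  assumes "mult_char \<chi>"
  shows "inv\<^bsub>char_group\<^esub> \<chi> = char_inv \<chi>"
proof -
  interpret comm_group char_group by (rule comm_group_char_group)
  show ?thesis
    using assms char_inv_mult[OF assms] mult_char_char_inv[OF assms]
    by (intro inv_equality) (auto simp: char_group_def)
qed

end

theory Submission
  imports Defs "HOL-Library.Cardinality"
begin

text \<open>
  Write \<open>p = 3k + 1\<close>. Up to the Jacobi sum, the hypergeometric value at \<open>z\<close> is
  \<open>P z = (\<Sum>y. \<eta> (f\<^sub>z y))\<close> with \<open>f\<^sub>z y = (1 - y) y\<^sup>2 (1 - z y)\<^sup>2\<close>.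
  The involution \<open>y \<mapsto> (1 - y) / (1 - z y)\<close> conjugates the summand, so for \<open>z \<noteq> 0, 1\<close> we have
  \<open>2 P z = 3 M - (p - 3)\<close>, where \<open>M < p\<close> counts the \<open>y\<close> for which \<open>f\<^sub>z y\<close> is a nonzero cube. The same
  computation with \<open>x \<mapsto> x ^ k\<close> in place of \<open>\<eta>\<close> shows that \<open>P z\<close> is determined by the element
  \<open>Q z = (\<Sum>y. f\<^sub>z y ^ k)\<close> of the prime field.

  An affine substitution gives \<open>Q (1 - z) = Q z\<close> for \<open>z \<noteq> 0, 1\<close>. Comparing coefficients modulo \<open>p\<close>,
  \<open>Q (\<lambda>\<^sup>3)\<close> is a sign times the sum of
  \<open>(\<lambda> (x\<^sup>3 + y\<^sup>3 + z\<^sup>3) - 3 x y z) ^ (p - 1)\<close> over all \<open>x, y, z\<close>, which up to sign counts, modulo \<open>p\<close>,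
  the zeros of a cubic of the Hesse pencil. The discrete Fourier transform of order 3 in
  \<open>(x, y, z)\<close> maps the cubic with parameter \<open>\<lambda>\<close> to the one with parameter
  \<open>(1 - \<lambda>) / (1 + 2 \<lambda>)\<close>.
\<close>

section \<open>Cyclicity, characteristic and power sums of finite fields\<close>

text \<open>The type is packed as a ring record so that cyclicity of the unit group of a finite
  field applies; the exact order of \<open>g\<close> then follows by counting.\<close>

lemma finite_field_generator:
  "\<exists>g :: 'a::{field,finite}. g \<noteq> 0 \<and> (\<forall>x. x \<noteq> 0 \<longrightarrow> (\<exists>n. x = g ^ n)) \<and>
     (\<forall>n. g ^ n = 1 \<longleftrightarrow> (CARD('a) - 1) dvd n)"
proof -
  define R :: "'a ring" where
    "R = \<lparr>carrier = UNIV, monoid.mult = (*), one = 1, ring.zero = 0, add = (+)\<rparr>"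
  have R: "carrier R = UNIV" "monoid.mult R = (*)" "\<one>\<^bsub>R\<^esub> = 1" "\<zero>\<^bsub>R\<^esub> = 0" "add R = (+)"
    by (simp_all add: R_def)
  have "\<exists>y. x + y = 0" for x :: 'a
    by (metis add.right_inverse)
  moreover have "\<exists>y. x * y = 1" if "x \<noteq> 0" for x :: 'a
    using that by (metis right_inverse)
  ultimately interpret R: field R
    by unfold_locales (auto simp: R Units_def algebra_simps)
  interpret M: group "mult_of R" by (rule R.field_mult_group)
  have pow: "x [^]\<^bsub>R\<^esub> n = x ^ n" for x and n :: nat
    by (induction n) (simp_all add: nat_pow_def R)
  have "finite (carrier R)" by (simp add: R)
  from R.finite_field_mult_group_has_gen[OF this]
  obtain g where 1: "g \<in> carrier (mult_of R)"
    and 2: "carrier (mult_of R) = {g [^]\<^bsub>R\<^esub> i |i :: nat. i \<in> UNIV}" by (elim bexE)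
  have g: "g \<noteq> 0" using 1 by (simp add: R)
  have gen: "UNIV - {0} = {g ^ i |i :: nat. i \<in> UNIV}"
    using 2 unfolding carrier_mult_of R pow .
  have fermat: "g ^ (CARD('a) - 1) = 1"
    using M.pow_order_eq_1[of g] g by (simp add: R.order_mult_of order_def R pow nat_pow_mult_of)
  have q: "CARD('a) > 1"
    using card_mono[of UNIV "{0, 1 :: 'a}"] by simp
  have "(CARD('a) - 1) dvd n" if "g ^ n = 1" for n
  proof (rule ccontr)
    define d where "d = n mod (CARD('a) - 1)"
    assume "\<not> (CARD('a) - 1) dvd n"
    then have d: "d > 0" "d < CARD('a) - 1" using q by (auto simp: d_def mod_greater_zero_iff_not_dvd)
    have "g ^ n = (g ^ (CARD('a) - 1)) ^ (n div (CARD('a) - 1)) * g ^ d"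
      by (simp add: d_def flip: power_mult power_add)
    then have gd: "g ^ d = 1" using that fermat by simp
    \<comment> \<open>Once \<open>g ^ d = 1\<close>, the powers of \<open>g\<close> take at most
      \<open>d\<close> values, too few to exhaust the nonzero elements.\<close>
    have "UNIV - {0} \<subseteq> (\<lambda>i. g ^ i) ` {..<d}"
    proof
      fix x assume "x \<in> UNIV - {0 :: 'a}"
      then obtain i where "x = g ^ i" using gen by auto
      also have "g ^ i = (g ^ d) ^ (i div d) * g ^ (i mod d)"
        by (simp flip: power_mult power_add)
      finally show "x \<in> (\<lambda>i. g ^ i) ` {..<d}" using gd d by auto
    qed
    then have "card (UNIV - {0 :: 'a}) \<le> card {..<d}"
      by (meson finite_imageI finite_lessThan card_image_le card_mono le_trans)
    then show False using d by (simp add: card_Diff_singleton)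
  qed
  moreover have "g ^ n = 1" if "(CARD('a) - 1) dvd n" for n
    using that fermat by (auto simp: power_mult)
  ultimately have "\<forall>n. g ^ n = 1 \<longleftrightarrow> (CARD('a) - 1) dvd n" by (intro allI iffI)
  then have "g ^ n = 1 \<longleftrightarrow> (CARD('a) - 1) dvd n" for n by (rule spec)
  moreover have "\<exists>n. x = g ^ n" if "x \<noteq> 0" for x
  proof -
    have "x \<in> UNIV - {0}" using that by simp
    then show ?thesis unfolding gen by simp
  qed
  ultimately show ?thesis using g by (intro exI[of _ g] conjI allI impI)
qed

lemma finite_field_power_card_minus_1:
  fixes x :: "'a::{field,finite}"
  assumes "x \<noteq> 0"
  shows "x ^ (CARD('a) - 1) = 1"
proof -
  obtain g :: 'a where g: "g \<noteq> 0" and gen: "\<forall>x. x \<noteq> 0 \<longrightarrow> (\<exists>n. x = g ^ n)"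
    and ord_g: "\<forall>n. g ^ n = 1 \<longleftrightarrow> (CARD('a) - 1) dvd n"
    using finite_field_generator[where ?'a = 'a] by (elim exE conjE) (rule that)
  obtain n where n: "x = g ^ n" using gen assms by auto
  show ?thesis unfolding n power_mult[symmetric] ord_g[rule_format] by simp
qed

text \<open>Translation by 1 permutes the ring, so it leaves the sum of all elements
  unchanged.\<close>

lemma of_nat_card_eq_0: "of_nat CARD('a::{ring_1,finite}) = (0 :: 'a)"
proof -
  have "(\<Sum>x\<in>UNIV. x :: 'a) = (\<Sum>x\<in>UNIV. x + 1)"
    by (rule sum.reindex_bij_witness[of _ "\<lambda>x. x + 1" "\<lambda>x. x - 1"]) auto
  then show ?thesis by (simp add: sum.distrib)
qed

lemma of_nat_eq_0_iff_card_dvd: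
  assumes "prime CARD('a::{field,finite})"
  shows "of_nat n = (0 :: 'a) \<longleftrightarrow> CARD('a) dvd n"
proof -
  have "CHAR('a) dvd CARD('a)"
    using of_nat_card_eq_0[where ?'a = 'a] by (simp only: of_nat_eq_0_iff_char_dvd)
  then have "CHAR('a) = CARD('a)"
    using assms CHAR_not_1 by (metis One_nat_def prime_nat_iff)
  then show ?thesis by (metis of_nat_eq_0_iff_char_dvd)
qed

text \<open>Scaling by a generator \<open>g\<close> multiplies the sum by \<open>g ^ n\<close>, so
  the sum vanishes unless \<open>g ^ n = 1\<close>. The case \<open>n = 0\<close> is special because
  \<open>0 ^ 0 = 1\<close>: the sum is then \<open>CARD('a)\<close>, which is 0 in the
  field.\<close>

lemma sum_power_finite_field:
  "(\<Sum>x\<in>UNIV. x ^ n :: 'a::{field,finite}) =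
    (if n > 0 \<and> (CARD('a) - 1) dvd n then - 1 else 0)"
proof -
  have card: "of_nat CARD('a) = (0 :: 'a)" by (rule of_nat_card_eq_0)
  consider "n = 0" | "n > 0" "(CARD('a) - 1) dvd n" | "n > 0" "\<not> (CARD('a) - 1) dvd n" by auto
  then show ?thesis
  proof cases
    case 2
    then have "x ^ n = 1" if "x \<noteq> 0" for x :: 'a
      using finite_field_power_card_minus_1[OF that] by (auto simp: power_mult)
    then have "(\<Sum>x\<in>UNIV. x ^ n) = (\<Sum>x\<in>UNIV - {0 :: 'a}. 1 :: 'a)"
      using 2 by (intro sum.mono_neutral_cong_right) (auto simp: power_0_left)
    also have "\<dots> = - 1" using card by (simp add: card_Diff_singleton of_nat_diff)
    finally show ?thesis using 2 by simp
  next
    case 3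
    obtain g :: 'a where g: "g \<noteq> 0" and gen: "\<forall>x. x \<noteq> 0 \<longrightarrow> (\<exists>n. x = g ^ n)"
      and ord_g: "\<forall>n. g ^ n = 1 \<longleftrightarrow> (CARD('a) - 1) dvd n"
      using finite_field_generator[where ?'a = 'a] by (elim exE conjE) (rule that)
    have "g ^ n \<noteq> 1" using ord_g 3 by simp
    have "(\<Sum>x\<in>UNIV. x ^ n) = (\<Sum>x\<in>UNIV. (g * x) ^ n)"
      using g by (intro sum.reindex_bij_witness[of _ "\<lambda>x. g * x" "\<lambda>x. x / g"]) auto
    also have "\<dots> = g ^ n * (\<Sum>x\<in>UNIV. x ^ n)"
      by (simp add: power_mult_distrib sum_distrib_left)
    finally show ?thesis using \<open>g ^ n \<noteq> 1\<close> 3 by simp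
  qed (use card in simp)
qed

section \<open>Cubic characters and their sums over \<open>cubic_arg\<close>\<close>

text \<open>The exponents 2, 1, 2 of \<open>y\<close>, \<open>1 - y\<close>,
  \<open>1 - z * y\<close> come from B, the inverse of B, and the inverse of A, for A = \<eta> and B
  = \<eta>^2 with \<eta>^3 trivial.\<close>

definition cubic_arg :: "'a::field \<Rightarrow> 'a \<Rightarrow> 'a" where
  "cubic_arg z y = (1 - y) * y ^ 2 * (1 - z * y) ^ 2"

text \<open>The codomain is any integral domain, so that the same lemmas serve a complex character
  and the map \<open>x ^ k\<close> into the field itself.\<close>

locale cubic_character =
  fixes \<theta> :: "'a::{field,finite} \<Rightarrow> 'b::idom"
  assumes zero: "\<theta> 0 = 0"
    and mult: "\<theta> (x * y) = \<theta> x * \<theta> y"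
    and cube: "x \<noteq> 0 \<Longrightarrow> \<theta> x ^ 3 = 1"
begin

lemma power: "n > 0 \<Longrightarrow> \<theta> (x ^ n) = \<theta> x ^ n"
  by (induction n rule: nat_induct_non_zero) (simp_all add: mult)

lemma mult_cube: "u \<noteq> 0 \<Longrightarrow> \<theta> (u ^ 3 * x) = \<theta> x"
  by (simp add: mult power cube)

text \<open>The substitution interchanges the two squared linear factors up to constants and
  rescales \<open>1 - y\<close>; the constants combine to a cube, which \<theta> ignores.\<close>

lemma sum_cubic_arg_one_minus:
  assumes "z \<noteq> 0" "z \<noteq> 1"
  shows "(\<Sum>y\<in>UNIV. \<theta> (cubic_arg (1 - z) y)) = (\<Sum>y\<in>UNIV. \<theta> (cubic_arg z y))"
proof (rule sum.reindex_bij_witness[of _ "\<lambda>y. (1 - z * y) / (1 - z)" "\<lambda>y. (1 - (1 - z) * y) / z"])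
  fix y
  define w where "w = (1 - (1 - z) * y) / z"
  have y: "y = (1 - z * w) / (1 - z)" using assms by (simp add: w_def field_simps)
  have "cubic_arg (1 - z) y = (- z / (1 - z)) ^ 3 * cubic_arg z w"
    unfolding y cubic_arg_def using assms by (simp add: divide_simps) (simp add: algebra_simps power_numeral_reduce)
  then show "\<theta> (cubic_arg z w) = \<theta> (cubic_arg (1 - z) y)"
    using assms mult_cube[of "- z / (1 - z)"] by simp
qed (use assms in \<open>auto simp: field_simps\<close>)

text \<open>The product of \<open>cubic_arg z\<close> at \<open>y\<close> and at its image under the
  involution \<open>\<sigma>\<close> is a nonzero cube, so the two values of \<theta> are inverse to
  each other, and the inverse of a cube root of unity is its square.\<close>

lemma sum_cubic_arg_square:
  assumes "z \<noteq> 1"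
  shows "(\<Sum>y\<in>UNIV. \<theta> (cubic_arg z y) ^ 2) = (\<Sum>y\<in>UNIV. \<theta> (cubic_arg z y))"
proof -
  define S where "S = {y. y \<noteq> 0 \<and> y \<noteq> 1 \<and> z * y \<noteq> 1}"
  define \<sigma> where "\<sigma> y = (1 - y) / (1 - z * y)" for y
  have S: "\<sigma> y \<in> S \<and> \<sigma> (\<sigma> y) = y \<and> \<theta> (cubic_arg z (\<sigma> y)) = \<theta> (cubic_arg z y) ^ 2"
    if "y \<in> S" for y
  proof -
    have nz: "y \<noteq> 0" "1 - y \<noteq> 0" "1 - z * y \<noteq> 0" "1 - z \<noteq> 0" using that assms by (auto simp: S_def)
    have 1: "1 - \<sigma> y = y * (1 - z) / (1 - z * y)" "1 - z * \<sigma> y = (1 - z) / (1 - z * y)"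
      using nz by (simp_all add: \<sigma>_def field_simps)
    have "\<sigma> y \<noteq> 0" "1 - \<sigma> y \<noteq> 0" "1 - z * \<sigma> y \<noteq> 0"
      unfolding 1 using nz by (simp_all add: \<sigma>_def)
    then have a: "\<sigma> y \<in> S" by (auto simp: S_def)
    have b: "\<sigma> (\<sigma> y) = y"
      unfolding \<sigma>_def[of "\<sigma> y"] 1 using nz by simp
    have "cubic_arg z (\<sigma> y) * cubic_arg z y = ((1 - y) * y * (1 - z) / (1 - z * y)) ^ 3 * 1"
    proof -
      have "(y * b / d) * (a / d) ^ 2 * (b / d) ^ 2 * (a * y ^ 2 * d ^ 2) = (a * y * b / d) ^ 3 * 1"
        if "d \<noteq> 0" for a b d
        using that by (simp add: field_simps power2_eq_square power3_eq_cube)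
      from this[OF nz(3), of "1 - z" "1 - y"] show ?thesis
        unfolding cubic_arg_def 1 unfolding \<sigma>_def .
    qed
    then have "\<theta> (cubic_arg z (\<sigma> y)) * \<theta> (cubic_arg z y) = \<theta> 1"
      using nz mult_cube[of "(1 - y) * y * (1 - z) / (1 - z * y)" 1] by (simp flip: mult)
    also have "\<dots> = \<theta> (cubic_arg z y) ^ 2 * \<theta> (cubic_arg z y)"
    proof -
      \<comment> \<open>\<open>\<theta> 1 = 1\<close> is not a locale assumption: it follows since
        \<open>\<theta> 1\<close> is a nonzero idempotent.\<close>
      have "\<theta> (1 * 1) = \<theta> 1 * \<theta> 1" "\<theta> 1 \<noteq> 0" using mult[of 1 1] cube[of 1] by auto
      moreover have "cubic_arg z y \<noteq> 0" using nz by (simp add: cubic_arg_def)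
      ultimately show ?thesis using cube[of "cubic_arg z y"] by (simp add: power2_eq_square power3_eq_cube)
    qed
    finally have "\<theta> (cubic_arg z (\<sigma> y)) = \<theta> (cubic_arg z y) ^ 2"
      using nz cube[of "cubic_arg z y"] by (auto simp: cubic_arg_def)
    with a b show ?thesis by blast
  qed
  have UNIV_S: "(\<Sum>y\<in>UNIV. \<theta> (cubic_arg z y) ^ n) = (\<Sum>y\<in>S. \<theta> (cubic_arg z y) ^ n)" if "n > 0" for n
    by (rule sum.mono_neutral_right) (use that in \<open>auto simp: S_def cubic_arg_def zero\<close>)
  have "(\<Sum>y\<in>S. \<theta> (cubic_arg z y) ^ 2) = (\<Sum>y\<in>S. \<theta> (cubic_arg z y))"
    by (rule sum.reindex_bij_witness[of _ \<sigma> \<sigma>]) (use S in auto)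
  then show ?thesis using UNIV_S[of 1] UNIV_S[of 2] by simp
qed

text \<open>Serves the degenerate parameters. The involution \<open>y / (y - 1)\<close> changes the
  argument by a sixth power; at the excluded point 1 both arguments vanish.\<close>

lemma sum_cubic_arg_0_eq_1:
  "(\<Sum>y\<in>UNIV. \<theta> (cubic_arg 0 y)) = (\<Sum>y\<in>UNIV. \<theta> (cubic_arg 1 y))"
proof -
  have "(\<Sum>y\<in>UNIV - {1}. \<theta> (cubic_arg 0 y)) = (\<Sum>y\<in>UNIV - {1}. \<theta> (cubic_arg 1 y))"
  proof (rule sum.reindex_bij_witness[of _ "\<lambda>y. y / (y - 1)" "\<lambda>y. y / (y - 1)"])
    fix y :: 'a assume "y \<in> UNIV - {1}"
    then have y: "y - 1 \<noteq> 0" "1 - y \<noteq> 0" "y \<noteq> 1" by auto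
    define w where "w = y / (y - 1)"
    have 1: "w - 1 = 1 / (y - 1)" using y by (simp add: w_def field_simps)
    then show "y / (y - 1) / (y / (y - 1) - 1) = y" "y / (y - 1) \<in> UNIV - {1}"
      using y unfolding w_def by auto
    have "1 - w = 1 / (1 - y)" using y by (simp add: w_def field_simps)
    then have "cubic_arg 1 w = (1 / (1 - y) ^ 2) ^ 3 * cubic_arg 0 y"
      unfolding cubic_arg_def mult_1_left unfolding w_def
      using y by (simp add: divide_simps) (simp add: algebra_simps power_numeral_reduce)
    then show "\<theta> (cubic_arg 1 w) = \<theta> (cubic_arg 0 y)"
      using y mult_cube[of "1 / (1 - y) ^ 2"] by simp
  qed (auto simp: field_simps)
  then show ?thesis
    by (simp add: sum.remove[of UNIV 1] cubic_arg_def)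
qed

text \<open>For a cube root of unity t, t + t^2 is 2 if t = 1 and -1 otherwise. The right-hand side
  involves only integers, which makes sums in different codomains comparable.\<close>

lemma sum_cubic_arg_eq_card:
  assumes "z \<noteq> 1"
  shows "2 * (\<Sum>y\<in>UNIV. \<theta> (cubic_arg z y)) =
    3 * of_nat (card {y. \<theta> (cubic_arg z y) = 1}) - of_nat (card {y. cubic_arg z y \<noteq> 0})"
proof -
  have *: "\<theta> x + \<theta> x ^ 2 = 3 * of_bool (\<theta> x = 1) - of_bool (x \<noteq> 0)" for x
  proof (cases "x = 0 \<or> \<theta> x = 1")
    case False
    then have "(\<theta> x - 1) * (\<theta> x ^ 2 + \<theta> x + 1) = 0" using cube[of x] by (simp add: algebra_simps power2_eq_square power3_eq_cube)
    then have "\<theta> x ^ 2 + \<theta> x + 1 = 0" using False by simp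
    then have "\<theta> x + \<theta> x ^ 2 = - 1" by (metis add.commute eq_neg_iff_add_eq_0)
    then show ?thesis using False by simp
  next
    case True
    then show ?thesis using cube[of x] by (auto simp: zero)
  qed
  have "2 * (\<Sum>y\<in>UNIV. \<theta> (cubic_arg z y)) =
      (\<Sum>y\<in>UNIV. \<theta> (cubic_arg z y) + \<theta> (cubic_arg z y) ^ 2)"
    using sum_cubic_arg_square[OF assms] by (simp add: sum.distrib)
  also have "\<dots> = 3 * of_nat (card {y. \<theta> (cubic_arg z y) = 1}) - of_nat (card {y. cubic_arg z y \<noteq> 0})"
    by (simp add: * sum_subtractf sum_of_bool_eq flip: sum_distrib_left)
  finally show ?thesis .
qed

end

lemma card_cubic_arg_nonzero:
  fixes z :: "'a::{field,finite}"
  assumes "z \<noteq> 0" "z \<noteq> 1"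
  shows "card {y. cubic_arg z y \<noteq> 0} = CARD('a) - 3"
proof -
  have "{y. cubic_arg z y \<noteq> 0} = UNIV - {0, 1, 1 / z}"
    using assms by (auto simp: cubic_arg_def field_simps)
  moreover have "card {0, 1, 1 / z} = 3" using assms by simp
  ultimately show ?thesis by (simp add: card_Diff_subset)
qed


section \<open>Coefficients of the field-valued sum and binomial identities modulo p\<close>

text \<open>After expanding both binomials, summation over \<open>y\<close> keeps only the exponent
  \<open>3 * k\<close>. What remains is, up to sign, the terminating Gauss series 2F1(-k, -2k; 1;
  z).\<close>

lemma sum_cubic_arg_power:
  fixes z :: "'a::{field,finite}"
  assumes card: "CARD('a) = Suc (3 * k)"
  shows "(\<Sum>y\<in>UNIV. cubic_arg z y ^ k) =
    - ((- 1) ^ k * (\<Sum>j\<le>k. of_nat (k choose j) * of_nat (2 * k choose j) * z ^ j))"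
proof -
  define c :: "nat \<Rightarrow> nat \<Rightarrow> 'a" where
    "c i j = of_nat (k choose i) * of_nat (2 * k choose j) * (- 1) ^ (i + j) * z ^ j" for i j
  define s :: "nat \<Rightarrow> 'a" where "s n = (\<Sum>y\<in>UNIV. y ^ n)" for n
  have "CARD('a) > 1"
    using card_mono[of UNIV "{0, 1 :: 'a}"] by simp
  then have k: "k > 0" using card by simp
  have expand: "cubic_arg z y ^ k = (\<Sum>i\<le>k. \<Sum>j\<le>2 * k. c i j * y ^ (2 * k + i + j))" for y
  proof -
    have "cubic_arg z y ^ k = (- y + 1) ^ k * y ^ (2 * k) * (- (z * y) + 1) ^ (2 * k)"
      by (simp add: cubic_arg_def power_mult_distrib flip: power_mult)
    also have "\<dots> = (\<Sum>i\<le>k. \<Sum>j\<le>2 * k. (of_nat (k choose i) * (- y) ^ i) * y ^ (2 * k) *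
        (of_nat (2 * k choose j) * (- (z * y)) ^ j))"
      unfolding binomial_ring[of "- y" 1] binomial_ring[of "- (z * y)" 1] power_one mult_1_right
        sum_distrib_right unfolding sum_distrib_left ..
    also have "\<dots> = (\<Sum>i\<le>k. \<Sum>j\<le>2 * k. c i j * y ^ (2 * k + i + j))"
      by (intro sum.cong refl) (simp add: c_def power_add power_minus[of y] power_minus[of "y * z"] power_mult_distrib mult_ac)
    finally show ?thesis .
  qed
  \<comment> \<open>The exponent lies between \<open>2 * k\<close> and \<open>5 * k\<close>, so
    \<open>3 * k\<close> is the only multiple of \<open>3 * k\<close> it can equal.\<close>
  have s: "s (2 * k + i + j) = (if j = k - i then - 1 else 0)" if "i \<le> k" "j \<le> 2 * k" for i j
  proof -
    have "3 * k dvd 2 * k + i + j \<longleftrightarrow> j = k - i"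
    proof
      assume "3 * k dvd 2 * k + i + j"
      then obtain m where m: "2 * k + i + j = 3 * k * m" by (auto simp: dvd_def)
      have "m > 0" using m k by (cases m) auto
      moreover have "m < 2"
      proof (rule ccontr)
        assume "\<not> m < 2"
        then have "3 * k * 2 \<le> 3 * k * m" by (intro mult_le_mono2) simp
        then show False using m that k by linarith
      qed
      ultimately have "m = 1" by simp
      then show "j = k - i" using m that by simp
    next
      assume "j = k - i"
      then have "2 * k + i + j = 3 * k" using that by simp
      then show "3 * k dvd 2 * k + i + j" by (simp only: dvd_refl)
    qed
    then show ?thesis
      using k by (simp add: s_def sum_power_finite_field card)
  qed
  have "(\<Sum>y\<in>UNIV. cubic_arg z y ^ k) = (\<Sum>i\<le>k. \<Sum>j\<le>2 * k. c i j * s (2 * k + i + j))"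
    by (simp add: expand s_def sum_distrib_left sum.swap[of _ "{..k}" UNIV] sum.swap[of _ "{..2 * k}" UNIV])
  also have "\<dots> = (\<Sum>i\<le>k. \<Sum>j\<le>2 * k. if j = k - i then - c i j else 0)"
    by (intro sum.cong refl) (simp add: s)
  also have "\<dots> = (\<Sum>i\<le>k. - c i (k - i))"
    by (intro sum.cong refl) (subst sum.delta, auto)
  also have "\<dots> = (\<Sum>j\<le>k. - c (k - j) j)"
    by (rule sum.reindex_bij_witness[of _ "\<lambda>j. k - j" "\<lambda>j. k - j"]) auto
  also have "\<dots> = (\<Sum>j\<le>k. - ((- 1) ^ k * (of_nat (k choose j) * of_nat (2 * k choose j) * z ^ j)))"
    by (intro sum.cong refl) (simp add: c_def mult_ac flip: binomial_symmetric)
  finally show ?thesis by (simp add: sum_negf sum_distrib_left)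
qed

text \<open>
  Since \<open>k = - 1 / 3\<close> in the field, both \<open>C(3k,3j) C(3j,j) C(2j,j) / (- 27) ^ j\<close> and
  \<open>C(k,j) C(2k,j)\<close> equal \<open>(1/3)\<^sub>j (2/3)\<^sub>j / j!\<^sup>2\<close>; clearing denominators gives this form.
\<close>

lemma factorial_identity:
  assumes p: "prime CARD('a::{field,finite})" and card: "CARD('a) = Suc (3 * k)" and "j \<le> k"
  shows "(of_nat (fact (3 * k) * fact (k - j) * fact (2 * k - j)) :: 'a) =
    (- 27) ^ j * of_nat (fact j * fact (3 * k - 3 * j) * fact k * fact (2 * k))"
  using \<open>j \<le> k\<close>
proof (induction j)
  case (Suc j)
  define m where "m = k - Suc j"
  have m: "k = m + Suc j" using Suc.prems by (simp add: m_def)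
  have "of_nat (Suc (3 * k)) = (0 :: 'a)"
    using of_nat_card_eq_0[where ?'a = 'a] by (simp only: card)
  then have k: "1 + 3 * of_nat k = (0 :: 'a)" by simp
  define u v :: 'a where "u = of_nat (m + 1)" and "v = of_nat (2 * k - j)"
  \<comment> \<open>Both integers are positive and smaller than p.\<close>
  have nz: "u \<noteq> 0" "v \<noteq> 0"
    unfolding u_def v_def of_nat_eq_0_iff_card_dvd[OF p] card
    using m by (auto dest!: dvd_imp_le)
  have fact: "fact (k - j) = (m + 1) * (fact m :: nat)"
    "fact (2 * k - j) = (2 * k - j) * (fact (2 * k - Suc j) :: nat)"
    "fact (3 * k - 3 * j) = (3 * m + 3) * (3 * m + 2) * (3 * m + 1) * (fact (3 * m) :: nat)"
    "fact (Suc j) = Suc j * (fact j :: nat)"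
  proof -
    have "k - j = Suc m" "2 * k - j = Suc (2 * k - Suc j)" "3 * k - 3 * j = Suc (Suc (Suc (3 * m)))"
      using m by auto
    then show "fact (k - j) = (m + 1) * (fact m :: nat)"
      "fact (2 * k - j) = (2 * k - j) * (fact (2 * k - Suc j) :: nat)"
      "fact (3 * k - 3 * j) = (3 * m + 3) * (3 * m + 2) * (3 * m + 1) * (fact (3 * m) :: nat)"
      by (simp_all add: algebra_simps)
  qed simp
  \<comment> \<open>As \<open>3 * k\<close> is -1 in the field, the three factors become
    \<open>3 * u\<close>, \<open>3 * v\<close> and -3 times \<open>Suc j\<close>; this is the source
    of -27.\<close>
  have key: "of_nat ((3 * m + 3) * (3 * m + 2) * (3 * m + 1)) = - 27 * of_nat (Suc j) * u * v"
  proof -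
    have v: "v = 2 * of_nat k - of_nat j"
      using m by (simp add: v_def of_nat_diff)
    have "of_nat k = (of_nat m + 1 + of_nat j :: 'a)" using m by simp
    then have m': "(of_nat m :: 'a) = of_nat k - 1 - of_nat j" by simp
    have "3 * of_nat m + 1 - - 3 * of_nat (Suc j) = (1 + 3 * of_nat k :: 'a)"
      "3 * of_nat m + 2 - 3 * v = - (1 + 3 * of_nat k :: 'a)"
      unfolding v m' by (simp_all add: algebra_simps)
    then have 1: "3 * of_nat m + 1 = - 3 * (of_nat (Suc j) :: 'a)" "3 * of_nat m + 2 = 3 * v"
      unfolding k by (simp_all only: right_minus_eq minus_zero)
    have "of_nat (3 * m + 3) = 3 * u" "of_nat (3 * m + 2) = 3 * v" "of_nat (3 * m + 1) = - 3 * (of_nat (Suc j) :: 'a)"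
      unfolding 1[symmetric] by (simp_all add: u_def distrib_left)
    then show ?thesis unfolding of_nat_mult by (simp only:) simp
  qed
  have "u * v * of_nat (fact (3 * k) * fact (k - Suc j) * fact (2 * k - Suc j)) =
      (of_nat (fact (3 * k) * fact (k - j) * fact (2 * k - j)) :: 'a)"
    unfolding fact u_def v_def m_def[symmetric] by (simp only: of_nat_mult mult_ac)
  also have "\<dots> = (- 27) ^ j * of_nat (fact j * fact (3 * k - 3 * j) * fact k * fact (2 * k))"
    using Suc by simp
  also have "\<dots> = (- 27) ^ j * of_nat ((3 * m + 3) * (3 * m + 2) * (3 * m + 1)) *
      of_nat (fact j * fact (3 * m) * fact k * fact (2 * k))"
    unfolding fact by (simp only: of_nat_mult mult_ac)
  also have "\<dots> = u * v * ((- 27) ^ Suc j *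
      of_nat (fact (Suc j) * fact (3 * m) * fact k * fact (2 * k)))"
    unfolding key fact by (simp only: of_nat_mult power_Suc mult_ac)
  also have "3 * m = 3 * k - 3 * Suc j" using m by simp
  finally show ?case using nz by (simp only: mult_cancel_left mult_eq_0_iff simp_thms)
qed simp

lemma multinomial_identity:
  assumes p: "prime CARD('a::{field,finite})" and card: "CARD('a) = Suc (3 * k)" and j: "j \<le> k"
  shows "(of_nat ((3 * k choose 3 * j) * (3 * j choose j) * (2 * j choose j)) :: 'a) =
    (- 27) ^ j * of_nat ((k choose j) * (2 * k choose j))" (is "of_nat ?M = _ * of_nat ?N")
proof -
  \<comment> \<open>A common denominator of both sides, invertible in the field because every
    factorial in it has an argument below p.\<close>
  define D :: nat where "D = fact j ^ 3 * fact (3 * k - 3 * j) * fact (k - j) * fact (2 * k - j)"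
  have nz: "of_nat D \<noteq> (0 :: 'a)"
    unfolding D_def of_nat_eq_0_iff_card_dvd[OF p]
      prime_dvd_mult_iff[OF p] prime_dvd_fact_iff[OF p]
    using j prime_dvd_power[OF p, of "fact j" 3] prime_dvd_fact_iff[OF p, of j] by (auto simp: card)
  have "fact (3 * k) = fact (3 * j) * fact (3 * k - 3 * j) * (3 * k choose 3 * j)"
    "fact (3 * j) = fact j * fact (3 * j - j) * (3 * j choose j)"
    "fact (2 * j) = fact j * fact (2 * j - j) * (2 * j choose j)"
    using j by (intro binomial_fact_lemma[symmetric]; simp)+
  then have M: "?M * (fact j ^ 3 * fact (3 * k - 3 * j)) = fact (3 * k)"
    by (simp add: power3_eq_cube)
  have "fact k = fact j * fact (k - j) * (k choose j)"
    "fact (2 * k) = fact j * fact (2 * k - j) * (2 * k choose j)"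
    using j by (intro binomial_fact_lemma[symmetric]; simp)+
  then have N: "?N * (fact j ^ 2 * fact (k - j) * fact (2 * k - j)) = fact k * fact (2 * k)"
    by (simp add: power2_eq_square)
  have "of_nat ?M * (of_nat D :: 'a) =
      of_nat (?M * (fact j ^ 3 * fact (3 * k - 3 * j)) * fact (k - j) * fact (2 * k - j))"
    by (simp only: D_def of_nat_mult mult_ac)
  also have "\<dots> = (- 27) ^ j * of_nat (fact j * fact (3 * k - 3 * j) * (fact k * fact (2 * k)))"
    unfolding M using factorial_identity[OF p card j] by (simp add: mult_ac)
  also have "\<dots> = (- 27) ^ j * of_nat ?N * (of_nat D :: 'a)"
    unfolding N[symmetric] by (simp add: D_def power2_eq_square power3_eq_cube mult_ac)
  finally show ?thesis using nz by simp
qed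


section \<open>The Hesse pencil and its Fourier symmetry\<close>

text \<open>For \<open>n = CARD('a) - 1\<close> each summand is the indicator that the cubic form is
  nonzero; the power form permits expansion in \<open>l\<close>.\<close>

definition hesse_sum :: "nat \<Rightarrow> 'a::{field,finite} \<Rightarrow> 'a" where
  "hesse_sum n l = (\<Sum>x\<in>UNIV. \<Sum>y\<in>UNIV. \<Sum>z\<in>UNIV.
     (l * (x ^ 3 + y ^ 3 + z ^ 3) - 3 * (x * y * z)) ^ n)"

text \<open>Each monomial sum splits into three one-variable power sums. Their exponents add up to
  \<open>9 * k\<close>, and a nonzero product needs each to be a positive multiple of
  \<open>3 * k\<close>, so all equal \<open>3 * k\<close>. The leading sign is the cube of
  -1.\<close>

lemma hesse_sum_expand:
  fixes l :: "'a::{field,finite}"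
  assumes card: "CARD('a) = Suc (3 * k)"
  shows "hesse_sum (3 * k) l = - (\<Sum>j\<le>k. of_nat ((3 * k choose 3 * j) * (3 * j choose j) * (2 * j choose j)) *
    (- 3) ^ (3 * k - 3 * j) * (l ^ 3) ^ j)"
proof -
  define c :: "nat \<times> nat \<times> nat \<Rightarrow> 'a" where
    "c = (\<lambda>(i, a, b). of_nat ((3 * k choose i) * (i choose a) * (i - a choose b)) *
       (- 3) ^ (3 * k - i) * l ^ i)"
  define s :: "nat \<Rightarrow> 'a" where "s n = (\<Sum>y\<in>UNIV. y ^ n)" for n
  \<comment> \<open>\<open>i\<close> counts the factors taken from the \<open>l\<close> part;
    \<open>a\<close>, \<open>b\<close> and \<open>i - a - b\<close> distribute them over the three
    cubes. \<open>e\<close> lists the resulting exponents of \<open>x\<close>, \<open>y\<close>,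
    \<open>z\<close>.\<close>
  define S where "S = (SIGMA i:{..3 * k}. SIGMA a:{..i}. {..i - a})"
  define e where "e = (\<lambda>(i, a, b). (3 * a + (3 * k - i), 3 * b + (3 * k - i), 3 * (i - a - b) + (3 * k - i)))"
  have "CARD('a) > 1"
    using card_mono[of UNIV "{0, 1 :: 'a}"] by simp
  then have k: "k > 0" using card by simp
  have expand: "(l * (x ^ 3 + y ^ 3 + z ^ 3) - 3 * (x * y * z)) ^ (3 * k) =
    (\<Sum>t\<in>S. c t * (case e t of (A, B, C) \<Rightarrow> x ^ A * y ^ B * z ^ C))" for x y z
  proof -
    have "(l * (x ^ 3 + y ^ 3 + z ^ 3) - 3 * (x * y * z)) ^ (3 * k) =
        (l * (x ^ 3 + (y ^ 3 + z ^ 3)) + - 3 * (x * y * z)) ^ (3 * k)"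
      by (simp add: add.assoc)
    also have "\<dots> = (\<Sum>i\<le>3 * k. \<Sum>a\<le>i. \<Sum>b\<le>i - a. of_nat (3 * k choose i) *
       (l ^ i * (of_nat (i choose a) * (x ^ 3) ^ a * (of_nat (i - a choose b) * (y ^ 3) ^ b * (z ^ 3) ^ (i - a - b)))) *
        (- 3 * (x * y * z)) ^ (3 * k - i))"
      unfolding binomial_ring[of "l * _"] power_mult_distrib[of l] binomial_ring[of "x ^ 3"]
        binomial_ring[of "y ^ 3"] sum_distrib_left sum_distrib_right ..
    also have "\<dots> = (\<Sum>i\<le>3 * k. \<Sum>a\<le>i. \<Sum>b\<le>i - a. c (i, a, b) *
        (case e (i, a, b) of (A, B, C) \<Rightarrow> x ^ A * y ^ B * z ^ C))"
    proof (intro sum.cong refl)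
      fix i a b
      show "of_nat (3 * k choose i) *
       (l ^ i * (of_nat (i choose a) * (x ^ 3) ^ a * (of_nat (i - a choose b) * (y ^ 3) ^ b * (z ^ 3) ^ (i - a - b)))) *
        (- 3 * (x * y * z)) ^ (3 * k - i) = c (i, a, b) *
        (case e (i, a, b) of (A, B, C) \<Rightarrow> x ^ A * y ^ B * z ^ C)"
        unfolding c_def e_def prod.case power_mult[symmetric] power_mult_distrib power_add of_nat_mult
        by (simp only: mult_ac)
    qed
    also have "\<dots> = (\<Sum>t\<in>S. c t * (case e t of (A, B, C) \<Rightarrow> x ^ A * y ^ B * z ^ C))"
      unfolding S_def by (simp add: sum.Sigma split_beta)
    finally show ?thesis .
  qed
  have "hesse_sum (3 * k) l = (\<Sum>t\<in>S. c t * (case e t of (A, B, C) \<Rightarrow> s A * s B * s C))"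
  proof -
    have sep: "(\<Sum>x\<in>UNIV. \<Sum>y\<in>UNIV. \<Sum>z\<in>UNIV. x ^ A * y ^ B * z ^ C :: 'a) = s A * s B * s C" for A B C
      unfolding s_def by (simp flip: sum_distrib_left sum_distrib_right)
    have "hesse_sum (3 * k) l = (\<Sum>t\<in>S. \<Sum>x\<in>UNIV. \<Sum>y\<in>UNIV. \<Sum>z\<in>UNIV.
        c t * (case e t of (A, B, C) \<Rightarrow> x ^ A * y ^ B * z ^ C))"
      unfolding hesse_sum_def expand by (simp only: sum.swap[of _ S UNIV])
    also have "\<dots> = (\<Sum>t\<in>S. c t * (case e t of (A, B, C) \<Rightarrow> s A * s B * s C))"
      by (intro sum.cong refl) (simp add: split_beta flip: sep sum_distrib_left)
    finally show ?thesis .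
  qed
  also have "\<dots> = (\<Sum>t\<in>(\<lambda>j. (3 * j, j, j)) ` {..k}. - c t)"
  proof (rule sum.mono_neutral_cong_right)
    show "finite S" by (simp add: S_def)
    show "(\<lambda>j. (3 * j, j, j)) ` {..k} \<subseteq> S" by (auto simp: S_def)
    show "\<forall>t\<in>S - (\<lambda>j. (3 * j, j, j)) ` {..k}. c t * (case e t of (A, B, C) \<Rightarrow> s A * s B * s C) = 0"
    proof
      fix t assume t: "t \<in> S - (\<lambda>j. (3 * j, j, j)) ` {..k}"
      obtain i a b where iab: "t = (i, a, b)" by (cases t)
      then have b: "i \<le> 3 * k" "a \<le> i" "b \<le> i - a" using t by (auto simp: S_def)
      have "(case e t of (A, B, C) \<Rightarrow> s A * s B * s C) = 0"
      proof (rule ccontr)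
        assume "\<not> ?thesis"
        then have "3 * k dvd 3 * a + (3 * k - i)" "3 * k dvd 3 * b + (3 * k - i)" "3 * k dvd 3 * (i - a - b) + (3 * k - i)"
          "3 * a + (3 * k - i) > 0" "3 * b + (3 * k - i) > 0" "3 * (i - a - b) + (3 * k - i) > 0"
          by (auto simp: iab e_def s_def sum_power_finite_field card split: if_splits)
        then have "3 * k \<le> 3 * a + (3 * k - i)" "3 * k \<le> 3 * b + (3 * k - i)" "3 * k \<le> 3 * (i - a - b) + (3 * k - i)"
          by (blast dest: dvd_imp_le)+
        then have "i = 3 * a" "b = a" using b by linarith+
        then show False using t b by (auto simp: iab)
      qed
      then show "c t * (case e t of (A, B, C) \<Rightarrow> s A * s B * s C) = 0"
        by (simp only: mult_zero_right)
    qed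
    show "c t * (case e t of (A, B, C) \<Rightarrow> s A * s B * s C) = - c t" if t: "t \<in> (\<lambda>j. (3 * j, j, j)) ` {..k}" for t
    proof -
      obtain j where "t = (3 * j, j, j)" "j \<le> k" using t by blast
      then show ?thesis using k by (simp add: e_def s_def sum_power_finite_field card)
    qed
  qed
  also have "\<dots> = (\<Sum>j\<le>k. - c (3 * j, j, j))"
    by (subst sum.reindex) (auto simp: inj_on_def)
  also have "\<dots> = (\<Sum>j\<le>k. - (of_nat ((3 * k choose 3 * j) * (3 * j choose j) * (2 * j choose j)) *
    (- 3) ^ (3 * k - 3 * j) * (l ^ 3) ^ j))"
  proof (intro sum.cong refl)
    fix j :: nat
    have "3 * j - j = 2 * j" by simp
    then show "- c (3 * j, j, j) = - (of_nat ((3 * k choose 3 * j) * (3 * j choose j) * (2 * j choose j)) *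
      (- 3) ^ (3 * k - 3 * j) * (l ^ 3) ^ j)"
      by (simp only: c_def prod.case power_mult)
  qed
  finally show ?thesis by (simp only: sum_negf)
qed

lemma three_neq_0:
  assumes "prime CARD('a::{field,finite})" "CARD('a) = Suc (3 * k)"
  shows "(3 :: 'a) \<noteq> 0"
proof -
  have "\<not> Suc (3 * k) dvd 3"
  proof
    assume "Suc (3 * k) dvd 3"
    then have "Suc (3 * k) = 3 \<or> k = 0" by (auto dest!: dvd_imp_le)
    then show False using assms by auto presburger
  qed
  then show ?thesis
    using of_nat_eq_0_iff_card_dvd[OF assms(1), of 3] assms(2) by simp
qed

text \<open>The coefficients agree because (-27)^j is (-3)^(3j), and the total power (-3)^(3k) is 1
  by Fermat.\<close>

lemma sum_cubic_arg_power_eq_hesse_sum: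
  fixes l :: "'a::{field,finite}"
  assumes p: "prime CARD('a)" and card: "CARD('a) = Suc (3 * k)"
  shows "(\<Sum>y\<in>UNIV. cubic_arg (l ^ 3) y ^ k) = (- 1) ^ k * hesse_sum (3 * k) l"
proof -
  have 27: "(- 3) ^ 3 = (- 27 :: 'a)" by (simp add: power3_eq_cube)
  have "of_nat ((3 * k choose 3 * j) * (3 * j choose j) * (2 * j choose j)) * (- 3) ^ (3 * k - 3 * j) =
     (of_nat (k choose j) * of_nat (2 * k choose j) :: 'a)" if "j \<le> k" for j
  proof -
    have "(- 27) ^ j * (- 3) ^ (3 * k - 3 * j) = (- 3 :: 'a) ^ (3 * j + (3 * k - 3 * j))"
      unfolding power_add power_mult 27 ..
    also have "\<dots> = 1"
      using finite_field_power_card_minus_1[of "- 3 :: 'a"] three_neq_0[OF p card] card that by simp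
    finally show ?thesis
      unfolding multinomial_identity[OF p card that] by (simp add: mult_ac)
  qed
  then show ?thesis
    unfolding sum_cubic_arg_power[OF card] hesse_sum_expand[OF card]
    by (simp add: sum_distrib_left)
qed

text \<open>The Fourier map \<open>\<phi>\<close> is a bijection carrying the form with parameter
  \<open>l'\<close> to a nonzero scalar multiple of the one with parameter \<open>l\<close>; the
  exponent \<open>3 * k\<close> turns the scalar into 1.\<close>

lemma hesse_sum_cubic_transformation:
  fixes l :: "'a::{field,finite}"
  assumes p: "prime CARD('a)" and card: "CARD('a) = Suc (3 * k)" and l: "1 + 2 * l \<noteq> 0"
  shows "hesse_sum (3 * k) ((1 - l) / (1 + 2 * l)) = hesse_sum (3 * k) l"
proof -
  define l' where "l' = (1 - l) / (1 + 2 * l)"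
  have three: "(3 :: 'a) \<noteq> 0" by (rule three_neq_0[OF p card])
  \<comment> \<open>A primitive cube root of unity, namely \<open>g ^ k\<close> for a generator
    \<open>g\<close> of order \<open>3 * k\<close>.\<close>
  obtain w :: 'a where w: "w ^ 2 + w + 1 = 0"
  proof -
    obtain g :: 'a where g: "g \<noteq> 0" and gen: "\<forall>x. x \<noteq> 0 \<longrightarrow> (\<exists>n. x = g ^ n)"
      and ord_g: "\<forall>n. g ^ n = 1 \<longleftrightarrow> (CARD('a) - 1) dvd n"
      using finite_field_generator[where ?'a = 'a] by (elim exE conjE) (rule that)
    have "k > 0" using p card by (cases k) auto
    then have "\<not> 3 * k dvd k" by (auto dest!: dvd_imp_le)
    then have 1: "g ^ k \<noteq> 1" using ord_g card by simp
    have "g ^ (k * 3) = 1" using ord_g card by simp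
    then have "(g ^ k) ^ 3 = 1" unfolding power_mult .
    moreover have "(w - 1) * (w ^ 2 + w + 1) = w ^ 3 - 1" for w :: 'a
      by (simp add: algebra_simps power2_eq_square power3_eq_cube)
    ultimately have "(g ^ k - 1) * ((g ^ k) ^ 2 + g ^ k + 1) = 0" by simp
    then show ?thesis using that[of "g ^ k"] 1 by simp
  qed
  define \<phi> where "\<phi> = (\<lambda>(x, y, z). (x + y + z, x + w * y + w ^ 2 * z, x + w ^ 2 * y + w * z))"
  define H where "H l = (\<lambda>(x, y, z). (l * (x ^ 3 + y ^ 3 + z ^ 3) - 3 * (x * y * z)) ^ (3 * k))" for l :: 'a
  have H: "hesse_sum (3 * k) l = sum (H l) UNIV" for l
    unfolding hesse_sum_def H_def UNIV_Times_UNIV[symmetric] sum.cartesian_product' by simp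
  \<comment> \<open>Inverse Fourier transform up to the factor 3, as polynomial identities with the
    multiple of \<open>w ^ 2 + w + 1\<close> split off.\<close>
  have "(x + y + z) + (x + w * y + w ^ 2 * z) + (x + w ^ 2 * y + w * z) =
      3 * x + (w ^ 2 + w + 1) * (y + z)"
    "(x + y + z) + w ^ 2 * (x + w * y + w ^ 2 * z) + w * (x + w ^ 2 * y + w * z) =
      3 * y + (w ^ 2 + w + 1) * (x + 2 * (w - 1) * y + (w ^ 2 - w + 1) * z)"
    "(x + y + z) + w * (x + w * y + w ^ 2 * z) + w ^ 2 * (x + w ^ 2 * y + w * z) =
      3 * z + (w ^ 2 + w + 1) * (x + 2 * (w - 1) * z + (w ^ 2 - w + 1) * y)" for x y z
    by (simp_all add: algebra_simps power2_eq_square)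
  note inverse = this[unfolded w mult_zero_left add_0_right]
  have "inj \<phi>"
  proof (rule injI)
    fix s t
    assume "\<phi> s = \<phi> t"
    obtain x y z where s: "s = (x, y, z)" by (cases s)
    obtain x' y' z' where t: "t = (x', y', z')" by (cases t)
    have "\<phi> (x, y, z) = \<phi> (x', y', z')" using \<open>\<phi> s = \<phi> t\<close> unfolding s t .
    then have eq: "x + y + z = x' + y' + z'" "x + w * y + w ^ 2 * z = x' + w * y' + w ^ 2 * z'"
       "x + w ^ 2 * y + w * z = x' + w ^ 2 * y' + w * z'" by (simp_all add: \<phi>_def)
    have "3 * x = 3 * x'" "3 * y = 3 * y'" "3 * z = 3 * z'"
      unfolding inverse[of x y z, symmetric] inverse[of x' y' z', symmetric] eq by (rule refl)+
    then show "s = t" unfolding s t using three by simp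
  qed
  then have "bij \<phi>" by (simp add: bij_def finite_UNIV_inj_surj)
  have "H l' (\<phi> t) = H l t" for t
  proof -
    obtain x y z where t: "t = (x, y, z)" by (cases t)
    define X Y Z where "X = x + y + z" and "Y = x + w * y + w ^ 2 * z" and "Z = x + w ^ 2 * y + w * z"
    define S P where "S = x ^ 3 + y ^ 3 + z ^ 3" and "P = x * y * z"
    have 1: "X ^ 3 + Y ^ 3 + Z ^ 3 = 3 * S + 18 * P" "X * Y * Z = S - 3 * P"
    proof -
      \<comment> \<open>The symmetric functions of \<open>Y\<close> and \<open>Z\<close> are free of
        \<open>w\<close>, and they suffice for both invariants.\<close>
      have "Y + Z = 2 * x - y - z + (w ^ 2 + w + 1) * (y + z)"
        by (simp add: Y_def Z_def algebra_simps)
      then have sum: "Y + Z = 2 * x - y - z" unfolding w by simp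
      have "Y * Z = x ^ 2 + y ^ 2 + z ^ 2 - x * y - x * z - y * z +
          (w ^ 2 + w + 1) * (x * y + x * z + (w - 1) * (y ^ 2 + z ^ 2) + (w ^ 2 - w + 1) * (y * z))"
        by (simp add: Y_def Z_def algebra_simps power2_eq_square)
      then have prod: "Y * Z = x ^ 2 + y ^ 2 + z ^ 2 - x * y - x * z - y * z" unfolding w by simp
      have "X ^ 3 + Y ^ 3 + Z ^ 3 = X ^ 3 + (Y + Z) ^ 3 - 3 * (Y * Z) * (Y + Z)"
        by (simp add: algebra_simps power2_eq_square power3_eq_cube)
      also have "\<dots> = 3 * S + 18 * P"
        unfolding sum prod X_def S_def P_def
        by (simp add: algebra_simps power2_eq_square power3_eq_cube)
      finally show "X ^ 3 + Y ^ 3 + Z ^ 3 = 3 * S + 18 * P" .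
      have "X * Y * Z = X * (Y * Z)" by (rule mult.assoc)
      also have "\<dots> = S - 3 * P"
        unfolding prod X_def S_def P_def
        by (simp add: algebra_simps power2_eq_square power3_eq_cube)
      finally show "X * Y * Z = S - 3 * P" .
    qed
    have "l' * (3 * S + 18 * P) - 3 * (S - 3 * P) = - 9 / (1 + 2 * l) * (l * S - 3 * P)"
      unfolding l'_def using l by (simp add: divide_simps) (simp add: algebra_simps)
    moreover have "(- 9 / (1 + 2 * l)) ^ (3 * k) = 1"
    proof -
      have "- 9 = - (3 * 3 :: 'a)" by simp
      then have "- 9 / (1 + 2 * l) \<noteq> 0" using three l by (metis divide_eq_0_iff mult_eq_0_iff neg_equal_0_iff_equal)
      from finite_field_power_card_minus_1[OF this] show ?thesis by (simp only: card diff_Suc_1)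
    qed
    ultimately show ?thesis
      unfolding H_def \<phi>_def t prod.case
      unfolding X_def[symmetric] Y_def[symmetric] Z_def[symmetric] S_def[symmetric] P_def[symmetric] 1
      by (simp only: power_mult_distrib mult_1_left)
  qed
  then have "sum (H l') UNIV = sum (H l) UNIV"
    using sum.reindex_bij_betw[OF \<open>bij \<phi>\<close>, of "H l'"] by simp
  then show ?thesis by (simp add: H l'_def)
qed


section \<open>The transformation for field-valued sums, and degenerate parameters\<close>

lemma cubic_character_power:
  assumes card: "CARD('a::{field,finite}) = Suc (3 * k)"
  shows "cubic_character (\<lambda>x :: 'a. x ^ k)"
proof
  have "CARD('a) > 1"
    using card_mono[of UNIV "{0, 1 :: 'a}"] by simp
  then show "(0 :: 'a) ^ k = 0" using card by simp
  show "(x ^ k) ^ 3 = 1" if "x \<noteq> 0" for x :: 'a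
    using finite_field_power_card_minus_1[OF that]
    by (simp add: card mult.commute flip: power_mult)
qed (simp add: power_mult_distrib)

lemma sum_cubic_arg_power_cubic_transformation:
  fixes l :: "'a::{field,finite}"
  assumes p: "prime CARD('a)" and card: "CARD('a) = Suc (3 * k)" and l: "1 + 2 * l \<noteq> 0"
    and l3: "1 - l ^ 3 \<noteq> 0" "1 - l ^ 3 \<noteq> 1"
  shows "(\<Sum>y\<in>UNIV. cubic_arg (1 - l ^ 3) y ^ k) =
    (\<Sum>y\<in>UNIV. cubic_arg (((1 - l) / (1 + 2 * l)) ^ 3) y ^ k)"
proof -
  interpret cubic_character "\<lambda>x :: 'a. x ^ k" by (rule cubic_character_power[OF card])
  have "(\<Sum>y\<in>UNIV. cubic_arg (1 - l ^ 3) y ^ k) = (\<Sum>y\<in>UNIV. cubic_arg (l ^ 3) y ^ k)"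
    using sum_cubic_arg_one_minus[OF l3] by simp
  then show ?thesis
    unfolding sum_cubic_arg_power_eq_hesse_sum[OF p card] hesse_sum_cubic_transformation[OF p card l] .
qed

text \<open>Every exceptional case forces \<open>l = 0\<close>, \<open>l = 1\<close> or
  \<open>l ^ 2 + l + 1 = 0\<close>. The first two make the arguments coincide; the third gives 0 and
  1, the pair treated by \<open>sum_cubic_arg_0_eq_1\<close>.\<close>

lemma cubic_transformation_degenerate:
  fixes l :: "'a::field"
  assumes l: "1 + 2 * l \<noteq> 0" and three: "(3 :: 'a) \<noteq> 0"
  defines "m \<equiv> ((1 - l) / (1 + 2 * l)) ^ 3"
  assumes deg: "1 - l ^ 3 \<in> {0, 1} \<or> m \<in> {0, 1}"
  shows "m = 1 - l ^ 3 \<or> (1 - l ^ 3 = 0 \<and> m = 1)"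
proof -
  have m: "m * (1 + 2 * l) ^ 3 = (1 - l) ^ 3"
    using l by (simp add: m_def power_divide)
  have "l = 0 \<or> l = 1 \<or> l ^ 2 + l + 1 = 0"
  proof -
    consider "1 - l ^ 3 = 0" | "1 - l ^ 3 = 1" | "m = 0" | "m = 1" using deg by auto
    then show ?thesis
    proof cases
      case 1
      then have "(l - 1) * (l ^ 2 + l + 1) = 0"
        by (simp add: algebra_simps power2_eq_square power3_eq_cube)
      then show ?thesis by simp
    next
      case 3
      then show ?thesis using m by simp
    next
      case 4
      have "3 * 3 * (l * (l ^ 2 + l + 1)) = (1 + 2 * l) ^ 3 - (1 - l) ^ 3"
        by (simp add: algebra_simps power2_eq_square power3_eq_cube)
      also have "\<dots> = 0" using m 4 by simp
      finally show ?thesis using three by (metis mult_eq_0_iff)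
    qed simp
  qed
  then show ?thesis
  proof (elim disjE)
    assume l2: "l ^ 2 + l + 1 = 0"
    have "(1 - l) ^ 3 - (1 + 2 * l) ^ 3 = - 3 * 3 * (l * (l ^ 2 + l + 1))"
      by (simp add: algebra_simps power2_eq_square power3_eq_cube)
    then have "(1 - l) ^ 3 = (1 + 2 * l) ^ 3" using l2 by simp
    then have "m = 1" using m l by simp
    moreover have "1 - l ^ 3 = (1 - l) * (l ^ 2 + l + 1)"
      by (simp add: algebra_simps power2_eq_square power3_eq_cube)
    ultimately show ?thesis using l2 by simp
  qed (auto simp: m_def)
qed

section \<open>Passage to a complex character of order 3\<close>

context
  fixes \<eta> :: "'a::{field,finite} \<Rightarrow> complex"
  assumes \<eta>: "\<eta> \<in> carrier char_group" and ord: "group.ord char_group \<eta> = 3"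
begin

interpretation G: comm_group char_group by (rule comm_group_char_group)

text \<open>Positivity matters at \<open>x = 0\<close>: the zeroth power is
  \<open>triv_char\<close>, which vanishes there, whereas \<open>0 ^ 0 = 1\<close>.\<close>

lemma char_group_pow: "n > 0 \<Longrightarrow> (\<eta> [^]\<^bsub>char_group\<^esub> (n :: nat)) x = \<eta> x ^ n"
proof (induction n rule: nat_induct_non_zero)
  case 1
  have "\<one>\<^bsub>char_group\<^esub> \<otimes>\<^bsub>char_group\<^esub> \<eta> = \<eta>" using \<eta> by simp
  then show ?case by simp
next
  case (Suc n)
  then show ?case by (simp add: char_group_def)
qed

lemma cubic_character_char: "cubic_character \<eta>"
proof
  show "\<eta> 0 = 0" "\<eta> (x * y) = \<eta> x * \<eta> y" for x y
    using \<eta> by (auto simp: char_group_def mult_char_def)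
  have "\<eta> [^]\<^bsub>char_group\<^esub> (3 :: nat) = \<one>\<^bsub>char_group\<^esub>"
    using G.pow_ord_eq_1[OF \<eta>] ord by simp
  then show "\<eta> x ^ 3 = 1" if "x \<noteq> 0" for x
    using char_group_pow[of 3 x] that by (simp add: char_group_def triv_char_def)
qed

interpretation cubic_character \<eta> by (rule cubic_character_char)

text \<open>For \<open>x = g ^ n\<close> with a generator \<open>g\<close>, both conditions say that
  3 divides \<open>n\<close>.\<close>

lemma cubic_character_eq_1_iff:
  assumes card: "CARD('a) = Suc (3 * k)" and "x \<noteq> 0"
  shows "\<eta> x = 1 \<longleftrightarrow> x ^ k = 1"
proof -
  obtain g :: 'a where g: "g \<noteq> 0" and gen: "\<forall>x. x \<noteq> 0 \<longrightarrow> (\<exists>n. x = g ^ n)"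
    and ord_g: "\<forall>n. g ^ n = 1 \<longleftrightarrow> (CARD('a) - 1) dvd n"
    using finite_field_generator[where ?'a = 'a] by (elim exE conjE) (rule that)
  have "\<eta> 1 = 1" using \<eta> by (simp add: char_group_def mult_char_def)
  then have pow: "\<eta> (g ^ n) = \<eta> g ^ n" for n by (induction n) (simp_all add: mult)
  \<comment> \<open>Exact order 3 enters here: \<open>\<eta> g = 1\<close> would make \<eta>
    trivial, hence of order 1.\<close>
  have "\<eta> g \<noteq> 1"
  proof
    assume 1: "\<eta> g = 1"
    have "\<eta> x = triv_char x" for x
      using gen[rule_format, of x] 1 pow by (cases "x = 0") (auto simp: triv_char_def zero)
    then have "\<eta> = \<one>\<^bsub>char_group\<^esub>" by (auto simp: char_group_def)
    then show False using ord by simp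
  qed
  obtain n where n: "x = g ^ n" using gen \<open>x \<noteq> 0\<close> by auto
  have "\<eta> g ^ n = 1 \<longleftrightarrow> 3 dvd n"
  proof -
    have "\<eta> g ^ n = (\<eta> g ^ 3) ^ (n div 3) * \<eta> g ^ (n mod 3)"
      by (simp flip: power_mult power_add)
    then have *: "\<eta> g ^ n = \<eta> g ^ (n mod 3)" using cube[OF g] by simp
    consider "n mod 3 = 0" | "n mod 3 = 1" | "n mod 3 = 2" by linarith
    then show ?thesis
    proof cases
      case 3
      have "\<eta> g ^ 2 \<noteq> 1"
        using cube[OF g] \<open>\<eta> g \<noteq> 1\<close> by (auto simp: power2_eq_square power3_eq_cube)
      then show ?thesis unfolding * 3 using 3 by (simp add: dvd_eq_mod_eq_0)
    qed (use * \<open>\<eta> g \<noteq> 1\<close> in \<open>simp_all add: dvd_eq_mod_eq_0\<close>)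
  qed
  moreover have "k > 0" using card card_mono[of UNIV "{0, 1 :: 'a}"] by (cases k) simp_all
  then have "x ^ k = 1 \<longleftrightarrow> 3 dvd n"
    unfolding n power_mult[symmetric] ord_g[rule_format] card by (simp add: mult.commute[of n])
  ultimately show ?thesis unfolding n pow by simp
qed

text \<open>Inversion is squaring on the values of \<eta>, also at 0 since
  \<open>inverse 0 = 0\<close>; the trivial factor C changes nothing because \<eta> already vanishes
  at 0.\<close>

lemma hyp_P21_eq_sum_cubic_arg:
  "hyp_P21 \<eta> (\<eta> [^]\<^bsub>char_group\<^esub> (2 :: nat)) \<one>\<^bsub>char_group\<^esub> z = (\<Sum>y\<in>UNIV. \<eta> (cubic_arg z y))"
proof -
  have inv: "inverse (\<eta> x) = \<eta> x ^ 2" "inverse (\<eta> x ^ 2) = \<eta> x" for x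
  proof -
    show "inverse (\<eta> x) = \<eta> x ^ 2"
    proof (cases "x = 0")
      case False
      then have "\<eta> x * \<eta> x ^ 2 = 1"
        using cube[of x] by (simp add: power2_eq_square power3_eq_cube mult.assoc)
      then show ?thesis by (rule inverse_unique)
    qed (simp add: zero)
    then show "inverse (\<eta> x ^ 2) = \<eta> x" by (metis inverse_inverse_eq)
  qed
  have "(\<one>\<^bsub>char_group\<^esub> \<otimes>\<^bsub>char_group\<^esub> char_inv (\<eta> [^]\<^bsub>char_group\<^esub> (2 :: nat))) x = \<eta> x" for x
    using char_group_pow[of 2 x]
    by (simp add: char_group_def triv_char_def char_inv_def inv zero)
  then show ?thesis
    by (simp add: hyp_P21_def char_inv_def char_group_pow inv cubic_arg_def mult power mult_ac)
qed

text \<open>The same count \<open>M z\<close> governs the complex and the field-valued sum. The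
  latter fixes it modulo p, and \<open>M z < CARD('a)\<close> then fixes it as an integer.\<close>

lemma sum_cubic_arg_char_eqI:
  assumes p: "prime CARD('a)" and card: "CARD('a) = Suc (3 * k)"
    and z: "z \<notin> {0, 1}" "z' \<notin> {0, 1}"
    and eq: "(\<Sum>y\<in>UNIV. cubic_arg z y ^ k) = (\<Sum>y\<in>UNIV. cubic_arg z' y ^ k)"
  shows "(\<Sum>y\<in>UNIV. \<eta> (cubic_arg z y)) = (\<Sum>y\<in>UNIV. \<eta> (cubic_arg z' y))"
proof -
  interpret P: cubic_character "\<lambda>x :: 'a. x ^ k" by (rule cubic_character_power[OF card])
  define M where "M z = card {y. \<eta> (cubic_arg z y) = 1}" for z
  define N where "N = CARD('a) - 3"
  have M_power: "{y. cubic_arg z y ^ k = 1} = {y. \<eta> (cubic_arg z y) = 1}" for z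
  proof -
    have "x ^ k = 1 \<longleftrightarrow> \<eta> x = 1" for x
      using cubic_character_eq_1_iff[OF card, of x] P.zero zero by (cases "x = 0") (auto simp: power_0_left)
    then show ?thesis by simp
  qed
  have C: "2 * (\<Sum>y\<in>UNIV. \<eta> (cubic_arg z y)) = 3 * of_nat (M z) - of_nat N"
    and F: "2 * (\<Sum>y\<in>UNIV. cubic_arg z y ^ k) = 3 * of_nat (M z) - of_nat N"
    if "z \<notin> {0, 1}" for z
    using sum_cubic_arg_eq_card[of z] P.sum_cubic_arg_eq_card[of z] card_cubic_arg_nonzero[of z] that
    by (simp_all add: M_def N_def M_power)
  have bound: "M z < CARD('a)" for z
  proof -
    have "{y. \<eta> (cubic_arg z y) = 1} \<subseteq> UNIV - {0}" by (auto simp: cubic_arg_def zero)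
    then have "M z \<le> card (UNIV - {0 :: 'a})" unfolding M_def by (rule card_mono[OF finite])
    then show ?thesis by (simp add: card_Diff_singleton card card_gt_0_iff)
  qed
  have "3 * of_nat (M z) = (3 * of_nat (M z') :: 'a)"
    using F[OF z(1)] F[OF z(2)] unfolding eq by auto
  then have eqF: "of_nat (M z) = (of_nat (M z') :: 'a)"
    using three_neq_0[OF p card] by simp
  have le: "b \<le> a" if "of_nat a = (of_nat b :: 'a)" "b < CARD('a)" for a b
  proof (rule ccontr)
    assume "\<not> b \<le> a"
    then have "of_nat (b - a) = (0 :: 'a)" using that by (simp add: of_nat_diff)
    then show False
      using that \<open>\<not> b \<le> a\<close> unfolding of_nat_eq_0_iff_card_dvd[OF p] by (auto dest!: dvd_imp_le)
  qed
  have "M z = M z'"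
    using le[OF eqF bound] le[OF eqF[symmetric] bound] by simp
  then have "2 * (\<Sum>y\<in>UNIV. \<eta> (cubic_arg z y)) = 2 * (\<Sum>y\<in>UNIV. \<eta> (cubic_arg z' y))"
    unfolding C[OF z(1)] C[OF z(2)] by simp
  then show ?thesis by simp
qed

lemma hyp_F21_eqI:
  assumes "(\<Sum>y\<in>UNIV. \<eta> (cubic_arg z y)) = (\<Sum>y\<in>UNIV. \<eta> (cubic_arg z' y))"
  shows "hyp_F21 \<eta> (\<eta> [^]\<^bsub>char_group\<^esub> (2 :: nat)) \<one>\<^bsub>char_group\<^esub> z =
    hyp_F21 \<eta> (\<eta> [^]\<^bsub>char_group\<^esub> (2 :: nat)) \<one>\<^bsub>char_group\<^esub> z'"
  using assms by (simp add: hyp_F21_def hyp_P21_eq_sum_cubic_arg)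

end

theorem corollary1p2:
  fixes p :: nat and \<eta> :: "'a::{field,finite} \<Rightarrow> complex" and l :: 'a
  assumes "prime p" and "[p = 1] (mod 3)" and "card (UNIV :: 'a set) = p"
    and "\<eta> \<in> carrier char_group" and "group.ord char_group \<eta> = 3"
    and "1 + 2 * l \<noteq> 0"
  shows "hyp_F21 \<eta> (\<eta> [^]\<^bsub>char_group\<^esub> (2::nat)) \<one>\<^bsub>char_group\<^esub> (1 - l ^ 3) =
    hyp_F21 \<eta> (\<eta> [^]\<^bsub>char_group\<^esub> (2::nat)) \<one>\<^bsub>char_group\<^esub> (((1 - l) / (1 + 2 * l)) ^ 3)"
proof -
  define m where "m = ((1 - l) / (1 + 2 * l)) ^ 3"
  have p: "prime CARD('a)" using assms by simp
  define k where "k = p div 3"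
  have "p mod 3 = 1" using assms(2) by (simp add: cong_def)
  then have card: "CARD('a) = Suc (3 * k)" unfolding k_def assms(3) by presburger
  have "(\<Sum>y\<in>UNIV. \<eta> (cubic_arg (1 - l ^ 3) y)) = (\<Sum>y\<in>UNIV. \<eta> (cubic_arg m y))"
  \<comment> \<open>The counting argument requires both arguments to avoid 0 and 1, where
    \<open>cubic_arg\<close> has three distinct zeros.\<close>
  proof (cases "1 - l ^ 3 \<in> {0, 1} \<or> m \<in> {0, 1}")
    case True
    then have "m = 1 - l ^ 3 \<or> (1 - l ^ 3 = 0 \<and> m = 1)"
      using cubic_transformation_degenerate[OF assms(6) three_neq_0[OF p card]] by (simp add: m_def)
    then show ?thesis
      using cubic_character.sum_cubic_arg_0_eq_1[OF cubic_character_char[OF assms(4,5)]] by auto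
  next
    case False
    then show ?thesis
      using sum_cubic_arg_power_cubic_transformation[OF p card assms(6)]
      by (intro sum_cubic_arg_char_eqI[OF assms(4,5) p card]) (auto simp: m_def)
  qed
  then show ?thesis
    unfolding m_def by (rule hyp_F21_eqI[OF assms(4,5)])
qed

end
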